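(* The solution to the fractional equations $$\frac{\mathrm{d}^\nu p_k}{\mathrm{d}t^\nu} = -\lambda_k p_k + \lambda_{k-1}p_{k-1},\qquad k\ge 1,\ 0<\nu\le 1,$$ with initial conditions $$p_k(0)=\begin{cases}1, & k=1,\\ 0, & k\ge 2,\end{cases}$$ is given by $$p_k^\nu(t)=\Pr\{\mathcal N_\nu(t)=k\mid \mathcal N_\nu(0)=1\}=\begin{cases}\displaystyle\prod_{j=1}^{k-1}\lambda_j\ \sum_{m=1}^{k}\left\{\frac{1}{\prod_{l=1,\,l\neq m}^{k}(\lambda_l-\lambda_m)}\,E_{\nu,1}(-\lambda_m t^\nu)\right\}, & k>1,\\[2mm] E_{\nu,1}(-\lambda_1 t^\nu), & k=1.\end{cases}$$
   Context: Here $t>0$, and $\mathcal N_\nu(t)$ denotes the number of individuals at time $t$ in the fractional nonlinear (generalized) birth process with birth rates $\lambda_k$, $k\ge1$, started from one progenitor; its state probabilities $p_k(t)=\Pr\{\mathcal N_\nu(t)=k\mid\mathcal N_\nu(0)=1\}$ are governed by the fractional equations in the claim, and the solutions of these equations are written $p_k^\nu(t)$. For $k=1$ the equation reads $\frac{\mathrm{d}^\nu p_1}{\mathrm{d}t^\nu}=-\lambda_1p_1$. The fractional derivative is understood in the Dzherbashyan--Caputo sense, that is, for $0<\nu<1$, $$\frac{\mathrm{d}^\nu p_k}{\mathrm{d}t^\nu}(t)=\frac{1}{\Gamma(1-\nu)}\int_0^t\frac{\frac{\mathrm{d}}{\mathrm{d}s}p_k(s)}{(t-s)^\nu}\,\mathrm{d}s,$$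 and for $\nu=1$ it is the ordinary first derivative. The Mittag-Leffler function is $E_{\nu,1}(x)=\sum_{h=0}^\infty\frac{x^h}{\Gamma(\nu h+1)}$, $x\in\mathbb R$, $\nu>0$. *)

theory Defs
  imports "HOL-Probability.Probability" "HOL-Library.Extended_Nat"
begin

definition mittag_leffler :: "real \<Rightarrow> real \<Rightarrow> real \<Rightarrow> real" where
  "mittag_leffler \<alpha> \<beta> x = (\<Sum>h. x ^ h / Gamma (\<alpha> * real h + \<beta>))"

text \<open>Dzherbashyan--Caputo derivative of order \<open>0 < \<nu> \<le> 1\<close> at a point \<open>t > 0\<close>, as a relation,
  so that an undefined derivative or a divergent integral is never given a default value.\<close>

definition has_caputo_derivative :: "real \<Rightarrow> (real \<Rightarrow> real) \<Rightarrow> real \<Rightarrow> real \<Rightarrow> bool" where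
  "has_caputo_derivative \<nu> f D t \<longleftrightarrow>
    (if \<nu> = 1 then (f has_real_derivative D) (at t)
     else (\<forall>s\<in>{0<..<t}. f differentiable (at s)) \<and>
          set_integrable lborel {0<..<t} (\<lambda>s. deriv f s / (t - s) powr \<nu>) \<and>
          D = 1 / Gamma (1 - \<nu>) * (LINT s:{0<..<t}|lborel. deriv f s / (t - s) powr \<nu>))"

text \<open>Continuity on \<open>[0, \<infinity>)\<close> ties the initial values to the equations, which are imposed
  only at times \<open>t > 0\<close>. The component \<open>p 0\<close> plays no role.\<close>

definition fractional_birth_solution ::
    "real \<Rightarrow> (nat \<Rightarrow> real) \<Rightarrow> (nat \<Rightarrow> real \<Rightarrow> real) \<Rightarrow> bool" where
  "fractional_birth_solution \<nu> lam p \<longleftrightarrow>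
    (\<forall>k\<ge>1. continuous_on {0..} (p k) \<and>
            p k 0 = (if k = 1 then 1 else 0) \<and>
            (\<forall>t>0. has_caputo_derivative \<nu> (p k)
               (if k = 1 then - lam 1 * p 1 t
                else - lam k * p k t + lam (k - 1) * p (k - 1) t) t))"

text \<open>The number of individuals takes values in \<^typ>\<open>enat\<close>, with \<open>\<infinity>\<close> accounting for explosion:
  no condition on the rates is imposed that would force the state probabilities to sum to 1.\<close>

definition fractional_birth_process ::
    "'a measure \<Rightarrow> (real \<Rightarrow> 'a \<Rightarrow> enat) \<Rightarrow> real \<Rightarrow> (nat \<Rightarrow> real) \<Rightarrow> bool" where
  "fractional_birth_process M N \<nu> lam \<longleftrightarrow>
    prob_space M \<and>
    (\<forall>t\<ge>0. N t \<in> measurable M (count_space UNIV)) \<and>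
    (AE \<omega> in M. N 0 \<omega> = 1) \<and>
    fractional_birth_solution \<nu> lam (\<lambda>k t. \<P>(\<omega> in M. N t \<omega> = enat k \<bar> N 0 \<omega> = 1))"

definition birth_state_prob :: "real \<Rightarrow> (nat \<Rightarrow> real) \<Rightarrow> nat \<Rightarrow> real \<Rightarrow> real" where
  "birth_state_prob \<nu> lam k t =
    (if k = 1 then mittag_leffler \<nu> 1 (- lam 1 * t powr \<nu>)
     else (\<Prod>j=1..k-1. lam j) *
          (\<Sum>m=1..k. 1 / (\<Prod>l\<in>{1..k} - {m}. lam l - lam m) *
                      mittag_leffler \<nu> 1 (- lam m * t powr \<nu>)))"

end

theory Submission imports Defs begin

text \<open>
  The equations form a triangular system: once \<open>p (k - 1)\<close> is known, the equation for \<open>p k\<close> is a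
  scalar relaxation equation with a given inflow. The theorem therefore splits into two facts
  about a single Caputo equation and one algebraic identity.

  Existence rests on the Mittag-Leffler function being the eigenfunction of the Caputo derivative
  (\<open>has_caputo_derivative_mittag_leffler\<close>): differentiating the series of
  \<open>mittag_leffler \<nu> 1 (l * t powr \<nu>)\<close> term by term and convolving each term with the kernel
  \<open>(t - s) powr - \<nu>\<close> is a Beta integral, and the Gamma factors shift the series by one index.
  The formula for \<open>p k\<close> is a linear combination of such eigenfunctions with
  \<open>l = - lam m\<close>, \<open>m \<le> k\<close>. Multiplying the coefficient of the \<open>m\<close>-th one at level \<open>k\<close> by
  \<open>lam k - lam m\<close> gives \<open>lam (k - 1)\<close> times its coefficient at level \<open>k - 1\<close>, which is precisely
  the balance of outflow and inflow. The initial value \<open>0\<close> for \<open>k \<ge> 2\<close> is the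
  vanishing of the divided difference of a constant function over at least two nodes
  (\<open>sum_inverse_prod_differences\<close>).

  For uniqueness, the difference of two solutions at level \<open>k\<close> satisfies, by induction on \<open>k\<close>,
  the homogeneous equation with initial value \<open>0\<close>. For \<open>\<nu> < 1\<close>, fractional integration of order
  \<open>\<nu>\<close> inverts the Caputo derivative up to the initial value (\<open>fractional_integral_caputo\<close>), so
  the difference solves a Volterra equation with a weakly singular kernel; iterating it bounds
  the difference by the terms of a convergent Mittag-Leffler series, hence it is zero
  (\<open>abel_gronwall\<close>). For \<open>\<nu> = 1\<close> an exponential integrating factor does the same.

  The state probabilities of a fractional birth process solve the equations by definition, so
  the uniqueness identifies them.
\<close>

section \<open>Gamma and Beta integrals\<close>

text \<open>The Beta integral moved to an arbitrary interval. It underlies all fractional integrals of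
  powers below, and with \<open>a + b = 1\<close> its value does not depend on the interval, which is
  why the Abel kernels of orders \<open>\<nu>\<close> and \<open>1 - \<nu>\<close> convolve to a constant.\<close>

lemma Beta_integral_interval:
  fixes a b s T :: real
  assumes "a > 0" "b > 0" "s < T"
  shows "has_bochner_integral lborel
           (\<lambda>x. indicator {s<..<T} x * ((x - s) powr (a - 1) * (T - x) powr (b - 1)))
           ((T - s) powr (a + b - 1) * Beta a b)"
proof -
  define c where "c = T - s"
  have c: "c > 0" using assms by (simp add: c_def)
  have int: "set_integrable lborel {0..1} (\<lambda>t. t powr (a - 1) * (1 - t) powr (b - 1))"
    using integrable_Beta assms by blast
  have "(LINT t:{0..1}|lborel. t powr (a - 1) * (1 - t) powr (b - 1)) = Beta a b"
    using set_borel_integral_eq_integral(2)[OF int] has_integral_Beta_real[of a b] assms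
    by (simp add: integral_unique)
  with int have "has_bochner_integral lborel
      (\<lambda>t. indicator {0..1} t *\<^sub>R (t powr (a - 1) * (1 - t) powr (b - 1))) (Beta a b)"
    by (simp add: set_integrable_def set_lebesgue_integral_def has_bochner_integral_iff)
  hence "has_bochner_integral lborel (\<lambda>t. c powr (a + b - 2) *
      (indicator {0..1} t *\<^sub>R (t powr (a - 1) * (1 - t) powr (b - 1)))) (c powr (a + b - 2) * Beta a b)"
    by (intro has_bochner_integral_mult_right) auto
  also have "(\<lambda>t. c powr (a + b - 2) *
      (indicator {0..1} t *\<^sub>R (t powr (a - 1) * (1 - t) powr (b - 1)))) =
     (\<lambda>t. (indicator {s<..<T} (s + c * t) * (((s + c * t) - s) powr (a - 1) * (T - (s + c * t)) powr (b - 1))))"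
  proof
    fix t
    have ind: "s + c * t \<in> {s<..<T} \<longleftrightarrow> t \<in> {0<..<1}"
    proof -
      have "T = s + c * 1" by (simp add: c_def)
      thus ?thesis using c by (simp add: zero_less_mult_iff)
    qed
    have T: "T - (s + c * t) = c * (1 - t)" by (simp add: c_def algebra_simps)
    show "c powr (a + b - 2) *
      (indicator {0..1} t *\<^sub>R (t powr (a - 1) * (1 - t) powr (b - 1))) =
     (indicator {s<..<T} (s + c * t) * (((s + c * t) - s) powr (a - 1) * (T - (s + c * t)) powr (b - 1)))"
    proof (cases "t \<in> {0<..<1}")
      case True
      have "c powr (a + b - 2) = c powr (a - 1) * c powr (b - 1)"
        by (simp flip: powr_add)
      thus ?thesis using True c ind unfolding T by (auto simp: powr_mult)
    next
      case False
      thus ?thesis using ind by (cases "t = 0 \<or> t = 1") (auto simp: indicator_def)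
    qed
  qed
  also have "c powr (a + b - 2) * Beta a b = (c powr (a + b - 1) * Beta a b) /\<^sub>R \<bar>c\<bar>"
  proof -
    have e: "c powr (a + b - 1) = c * c powr (a + b - 2)"
      using c powr_mult_base[of c "a + b - 2"] by (simp add: algebra_simps)
    show ?thesis unfolding e using c by simp
  qed
  finally show ?thesis
    using c by (subst lborel_has_bochner_integral_real_affine_iff[of c _ _ s]) (auto simp: c_def)
qed

text \<open>Growth of Gamma faster than any exponential, obtained by discarding the part of Euler's integral
  below \<open>c\<close>. The free parameter \<open>c\<close> is what lets the bound beat any geometric series.\<close>

lemma Gamma_plus1_lower_bound:
  fixes x c :: real
  assumes "x \<ge> 0" "c \<ge> 0"
  shows "c powr x * exp (-c) \<le> Gamma (x + 1)"
proof -
  have "((\<lambda>t. exp (- 1 * t)) has_integral exp (- 1 * c) / 1) {c..}"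
    by (rule has_integral_exp_minus_to_infinity) auto
  from has_integral_mult_right[OF this, of "c powr x"]
  have "((\<lambda>t. c powr x * exp (- t)) has_integral (c powr x * exp (-c))) {c..}"
    by simp
  hence "((\<lambda>t. if t \<in> {c..} then c powr x * exp (- t) else 0) has_integral (c powr x * exp (-c))) {0..}"
    using assms by (subst has_integral_restrict) auto
  moreover have "((\<lambda>t. t powr x / exp t) has_integral Gamma (x + 1)) {0..}"
    using Gamma_integral_real[of "x + 1"] assms by simp
  ultimately show ?thesis
    by (rule has_integral_le) (use assms in \<open>auto simp: exp_minus divide_inverse powr_mono2\<close>)
qed

section \<open>Convergence of the Mittag-Leffler series\<close>

lemma summable_mittag_leffler:
  fixes \<nu> x :: real
  assumes "\<nu> > 0"
  shows "summable (\<lambda>h. 1 / Gamma (\<nu> * real h + 1) * x ^ h)"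
proof -
  \<comment> \<open>Chosen so that \<open>c powr \<nu>\<close> exceeds \<open>2 * \<bar>x\<bar>\<close>, making the terms decay at least like \<open>(1/2) ^ h\<close>.\<close>
  define c where "c = (2 * \<bar>x\<bar> + 1) powr (1 / \<nu>)"
  have c: "c > 0" "c powr \<nu> = 2 * \<bar>x\<bar> + 1"
    using assms by (auto simp: c_def powr_powr)
  have "summable (\<lambda>h. exp c * (1/2::real) ^ h)"
    by (intro summable_mult summable_geometric) auto
  thus ?thesis
  proof (rule summable_comparison_test'[where N = 0])
    fix h :: nat
    have "c powr (\<nu> * real h) = (2 * \<bar>x\<bar> + 1) ^ h"
      using c by (simp add: powr_powr[symmetric] powr_realpow)
    hence *: "(2 * \<bar>x\<bar> + 1) ^ h * exp (- c) \<le> Gamma (\<nu> * real h + 1)"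
      using Gamma_plus1_lower_bound[of "\<nu> * real h" c] assms c by simp
    have pos: "0 < (2 * \<bar>x\<bar> + 1) ^ h * exp (- c)" by (intro mult_pos_pos) auto
    have "norm (1 / Gamma (\<nu> * real h + 1) * x ^ h) = \<bar>x\<bar> ^ h / Gamma (\<nu> * real h + 1)"
      using order.strict_trans2[OF pos *] by (simp add: abs_mult power_abs)
    also have "\<dots> \<le> \<bar>x\<bar> ^ h / ((2 * \<bar>x\<bar> + 1) ^ h * exp (- c))"
      using * pos order.strict_trans2[OF pos *] by (intro divide_left_mono mult_pos_pos) auto
    also have "\<dots> = exp c * (\<bar>x\<bar> / (2 * \<bar>x\<bar> + 1)) ^ h"
      by (simp add: exp_minus field_simps power_divide)
    also have "\<dots> \<le> exp c * (1/2) ^ h"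
      by (intro mult_left_mono power_mono) (auto simp: field_simps)
    finally show "norm (1 / Gamma (\<nu> * real h + 1) * x ^ h) \<le> exp c * (1/2) ^ h" .
  qed
qed

section \<open>A divided-difference identity\<close>

text \<open>Up to sign the sum is the divided difference of the constant function \<open>1\<close> over the nodes \<open>A\<close>.
  The proof is the recursion for divided differences: multiplying by \<open>b - a = (b - m) - (a - m)\<close>
  leaves the difference of the sums over \<open>A - {b}\<close> and \<open>A - {a}\<close>. These are both \<open>1\<close> if \<open>A\<close>
  has two elements, and both \<open>0\<close> by induction otherwise.\<close>

lemma sum_inverse_prod_differences:
  fixes A :: "'a :: field set"
  assumes "finite A" "card A \<ge> 2"
  shows "(\<Sum>m\<in>A. 1 / (\<Prod>l\<in>A - {m}. l - m)) = 0"
  using assms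
proof (induction "card A" arbitrary: A rule: less_induct)
  case less
  define S where "S B = (\<Sum>m\<in>B. 1 / (\<Prod>l\<in>B - {m}. l - m))" for B :: "'a set"
  have rem: "(\<Sum>m\<in>A. (b - m) / (\<Prod>l\<in>A - {m}. l - m)) = S (A - {b})" if "b \<in> A" for b
  proof -
    have "(\<Sum>m\<in>A. (b - m) / (\<Prod>l\<in>A - {m}. l - m)) =
          (\<Sum>m\<in>A - {b}. (b - m) / (\<Prod>l\<in>A - {m}. l - m))"
      using less.prems that by (subst sum.remove[of A b]) auto
    also have "\<dots> = S (A - {b})"
      unfolding S_def
    proof (intro sum.cong refl)
      fix m assume m: "m \<in> A - {b}"
      have "A - {m} = insert b (A - {b} - {m})" using m that by auto
      hence "(\<Prod>l\<in>A - {m}. l - m) = (b - m) * (\<Prod>l\<in>A - {b} - {m}. l - m)"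
        using less.prems by simp
      moreover have "b - m \<noteq> 0" using m by auto
      ultimately show "(b - m) / (\<Prod>l\<in>A - {m}. l - m) = 1 / (\<Prod>l\<in>A - {b} - {m}. l - m)"
        by (metis mult_divide_mult_cancel_left mult.right_neutral)
    qed
    finally show ?thesis .
  qed
  obtain a b where ab: "a \<in> A" "b \<in> A" "a \<noteq> b"
    using less.prems card_le_Suc0_iff_eq[of A] by auto
  have "(b - a) * S A = (\<Sum>m\<in>A. ((b - m) - (a - m)) / (\<Prod>l\<in>A - {m}. l - m))"
    by (simp add: S_def sum_distrib_left)
  also have "\<dots> = S (A - {b}) - S (A - {a})"
    unfolding rem[OF ab(1), symmetric] rem[OF ab(2), symmetric]
    by (simp add: sum_subtractf diff_divide_distrib)
  also have "\<dots> = 0"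
  proof (cases "card A = 2")
    case True
    have "A = {a, b}"
      using True ab less.prems by (intro card_seteq[symmetric]) auto
    thus ?thesis using ab by (simp add: S_def insert_Diff_if)
  next
    case False
    have "S (A - {x}) = 0" if "x \<in> A" for x
      unfolding S_def using that False less.prems
      by (intro less.hyps) (auto simp: card_Diff_singleton)
    thus ?thesis using ab by simp
  qed
  finally show ?case using ab by (simp add: S_def)
qed

section \<open>Basic rules for the Caputo derivative\<close>

lemma has_caputo_derivative_add:
  assumes "has_caputo_derivative \<nu> f D t" "has_caputo_derivative \<nu> g E t"
  shows "has_caputo_derivative \<nu> (\<lambda>s. f s + g s) (D + E) t"
proof (cases "\<nu> = 1")
  case True
  thus ?thesis using assms by (auto simp: has_caputo_derivative_def intro: DERIV_add)
next
  case False
  let ?w = "\<lambda>h s. deriv h s / (t - s) powr \<nu>"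
  from assms False have diff: "\<And>s. s \<in> {0<..<t} \<Longrightarrow> f differentiable (at s)"
      "\<And>s. s \<in> {0<..<t} \<Longrightarrow> g differentiable (at s)"
    and int: "set_integrable lborel {0<..<t} (?w f)" "set_integrable lborel {0<..<t} (?w g)"
    and val: "D = 1 / Gamma (1 - \<nu>) * (LINT s:{0<..<t}|lborel. ?w f s)"
      "E = 1 / Gamma (1 - \<nu>) * (LINT s:{0<..<t}|lborel. ?w g s)"
    by (auto simp: has_caputo_derivative_def)
  have eq: "?w (\<lambda>s. f s + g s) s = ?w f s + ?w g s" if "s \<in> {0<..<t}" for s
    using diff[OF that] by (simp add: deriv_add add_divide_distrib
        field_differentiable_def real_differentiable_def)
  have "set_integrable lborel {0<..<t} (?w (\<lambda>s. f s + g s))"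
    using set_integral_add(1)[OF int] by (subst set_integrable_cong[OF refl refl eq]) auto
  moreover have "(LINT s:{0<..<t}|lborel. ?w (\<lambda>s. f s + g s) s) =
      (LINT s:{0<..<t}|lborel. ?w f s) + (LINT s:{0<..<t}|lborel. ?w g s)"
    using eq by (subst set_integral_add(2)[OF int, symmetric])
      (auto intro!: set_lebesgue_integral_cong)
  ultimately show ?thesis
    using False diff by (simp add: has_caputo_derivative_def val distrib_left add_divide_distrib)
qed

lemma has_caputo_derivative_cmult:
  assumes "has_caputo_derivative \<nu> f D t"
  shows "has_caputo_derivative \<nu> (\<lambda>s. c * f s) (c * D) t"
proof (cases "\<nu> = 1")
  case True
  thus ?thesis using assms by (auto simp: has_caputo_derivative_def intro: DERIV_cmult)
next
  case False
  let ?w = "\<lambda>h s. deriv h s / (t - s) powr \<nu>"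
  from assms False have diff: "\<And>s. s \<in> {0<..<t} \<Longrightarrow> f differentiable (at s)"
    and int: "set_integrable lborel {0<..<t} (?w f)"
    and val: "D = 1 / Gamma (1 - \<nu>) * (LINT s:{0<..<t}|lborel. ?w f s)"
    by (auto simp: has_caputo_derivative_def)
  have eq: "?w (\<lambda>s. c * f s) s = c * ?w f s" if "s \<in> {0<..<t}" for s
    using diff[OF that] by (simp add: deriv_cmult field_differentiable_def real_differentiable_def)
  have "set_integrable lborel {0<..<t} (?w (\<lambda>s. c * f s))"
    using set_integrable_mult_right[OF int, of c]
    by (subst set_integrable_cong[OF refl refl eq]) (auto simp del: times_divide_eq_right)
  moreover have "(LINT s:{0<..<t}|lborel. ?w (\<lambda>s. c * f s) s) =
      c * (LINT s:{0<..<t}|lborel. ?w f s)"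
    using eq by (subst set_integral_mult_right[symmetric])
      (auto intro!: set_lebesgue_integral_cong)
  ultimately show ?thesis
    using False diff by (simp add: has_caputo_derivative_def val)
qed

lemma has_caputo_derivative_const: "has_caputo_derivative \<nu> (\<lambda>s. c) 0 t"
  by (simp add: has_caputo_derivative_def set_integrable_def set_lebesgue_integral_def)

lemma has_caputo_derivative_sum:
  assumes "\<And>i. i \<in> A \<Longrightarrow> has_caputo_derivative \<nu> (f i) (D i) t"
  shows "has_caputo_derivative \<nu> (\<lambda>s. \<Sum>i\<in>A. f i s) (\<Sum>i\<in>A. D i) t"
  using assms
  by (induction A rule: infinite_finite_induct)
     (auto intro: has_caputo_derivative_const has_caputo_derivative_add)

text \<open>The derivative at \<open>t\<close> depends only on values at positive times: it is built from derivatives at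
  points of \<open>{0<..t}\<close>, each of which is interior to \<open>{0<..}\<close>.\<close>

lemma has_caputo_derivative_cong:
  assumes "\<And>s. s > 0 \<Longrightarrow> f s = g s" and "t > 0"
  shows "has_caputo_derivative \<nu> f D t \<longleftrightarrow> has_caputo_derivative \<nu> g D t"
proof -
  have ev: "\<forall>\<^sub>F x in nhds s. f x = g x" if "s > 0" for s
    using that assms by (auto simp: eventually_nhds intro!: exI[of _ "{0<..}"])
  have "(f has_real_derivative E) (at s) \<longleftrightarrow> (g has_real_derivative E) (at s)" if "s > 0" for s E
    using ev[OF that] by (intro DERIV_cong_ev refl) auto
  hence D: "(f has_real_derivative E) (at s) \<longleftrightarrow> (g has_real_derivative E) (at s)"
      and "f differentiable (at s) \<longleftrightarrow> g differentiable (at s)"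
      and "deriv f s = deriv g s" if "s > 0" for s E
    using that by (auto simp: real_differentiable_def deriv_def)
  note eqs = this
  show ?thesis
  proof (cases "\<nu> = 1")
    case True
    thus ?thesis using D[OF \<open>t > 0\<close>] by (simp add: has_caputo_derivative_def)
  next
    case False
    have "set_integrable lborel {0<..<t} (\<lambda>s. deriv f s / (t - s) powr \<nu>) \<longleftrightarrow>
          set_integrable lborel {0<..<t} (\<lambda>s. deriv g s / (t - s) powr \<nu>)"
      using eqs by (intro set_integrable_cong) auto
    moreover have "(LINT s:{0<..<t}|lborel. deriv f s / (t - s) powr \<nu>) =
        (LINT s:{0<..<t}|lborel. deriv g s / (t - s) powr \<nu>)"
      using eqs by (intro set_lebesgue_integral_cong) auto
    ultimately show ?thesis using False eqs by (simp add: has_caputo_derivative_def)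
  qed
qed

section \<open>The Mittag-Leffler function as Caputo eigenfunction\<close>

text \<open>The derivative is written as a series of pure powers of \<open>s\<close>, the form to which the Beta
  integral applies. The functional equation of Gamma absorbs the factor \<open>\<nu> * real (Suc h)\<close>
  that comes from differentiating.\<close>

lemma mittag_leffler_powr_derivative:
  fixes \<nu> l s :: real
  assumes "\<nu> > 0" "s > 0"
  defines "g \<equiv> \<lambda>h. l ^ Suc h / Gamma (\<nu> * real (Suc h)) * s powr (\<nu> * real (Suc h) - 1)"
  shows "((\<lambda>s. mittag_leffler \<nu> 1 (l * s powr \<nu>)) has_real_derivative (\<Sum>h. g h)) (at s)" (is ?D)
    and "summable (\<lambda>h. \<bar>g h\<bar>)" (is ?S)
proof -
  define c where "c h = 1 / Gamma (\<nu> * real h + 1)" for h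
  have summable: "summable (\<lambda>h. c h * x ^ h)" for x
    using summable_mittag_leffler[OF assms(1)] by (simp add: c_def)
  have diffs: "diffs c h = 1 / (\<nu> * Gamma (\<nu> * real (Suc h)))" for h
  proof -
    have "\<nu> * real (Suc h) > 0" using assms by simp
    hence "Gamma (\<nu> * real (Suc h) + 1) = \<nu> * real (Suc h) * Gamma (\<nu> * real (Suc h))"
      by (intro Gamma_plus1) (auto simp del: of_nat_Suc elim!: nonpos_Ints_cases)
    thus ?thesis by (simp add: diffs_def c_def del: of_nat_Suc)
  qed
  have g_eq: "g h = diffs c h * (l * s powr \<nu>) ^ h * (l * (\<nu> * s powr (\<nu> - 1)))" for h
  proof -
    have "s powr (\<nu> * real (Suc h) - 1) = s powr (\<nu> * real h) * s powr (\<nu> - 1)"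
      by (simp add: algebra_simps flip: powr_add)
    also have "s powr (\<nu> * real h) = (s powr \<nu>) ^ h"
      using assms by (simp add: powr_powr[symmetric] powr_realpow)
    finally show ?thesis using assms(1) by (simp add: g_def diffs power_mult_distrib del: of_nat_Suc)
  qed
  have E: "mittag_leffler \<nu> 1 x = (\<Sum>h. c h * x ^ h)" for x
    by (simp add: mittag_leffler_def c_def)
  have "((\<lambda>s. \<Sum>h. c h * (l * s powr \<nu>) ^ h) has_real_derivative
      (\<Sum>h. diffs c h * (l * s powr \<nu>) ^ h) * (l * (\<nu> * s powr (\<nu> - 1)))) (at s)"
    by (rule DERIV_chain2[OF termdiffs_strong_converges_everywhere[OF summable]])
       (use assms in \<open>auto intro!: derivative_eq_intros\<close>)
  also have "(\<Sum>h. diffs c h * (l * s powr \<nu>) ^ h) * (l * (\<nu> * s powr (\<nu> - 1))) = (\<Sum>h. g h)"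
    unfolding g_eq by (intro suminf_mult2 termdiff_converges_all summable)
  finally show ?D unfolding E .
  have "summable (\<lambda>h. diffs c h * (\<bar>l\<bar> * s powr \<nu>) ^ h * (\<bar>l\<bar> * (\<nu> * s powr (\<nu> - 1))))"
    by (intro summable_mult2 termdiff_converges_all summable)
  moreover have "diffs c h \<ge> 0" for h
    using assms unfolding diffs by (auto intro!: divide_nonneg_nonneg mult_nonneg_nonneg Gamma_real_nonneg)
  ultimately show ?S
    using assms(1,2) by (simp add: g_eq abs_mult power_abs)
qed

text \<open>For \<open>\<nu> < 1\<close> the term of index \<open>Suc h\<close> of the differentiated series integrates against the
  kernel to \<open>Gamma (1 - \<nu>) * l\<close> times the term of index \<open>h\<close> of the original series.
  The same computation with \<open>\<bar>l\<bar>\<close> in place of \<open>l\<close> gives the \<open>L\<^sup>1\<close> norms of the terms; their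
  summability justifies exchanging sum and integral.\<close>

lemma has_caputo_derivative_mittag_leffler:
  fixes \<nu> l t :: real
  assumes "0 < \<nu>" "\<nu> \<le> 1" "t > 0"
  shows "has_caputo_derivative \<nu> (\<lambda>s. mittag_leffler \<nu> 1 (l * s powr \<nu>))
           (l * mittag_leffler \<nu> 1 (l * t powr \<nu>)) t"
proof -
  define E where "E s = mittag_leffler \<nu> 1 (l * s powr \<nu>)" for s
  define g where "g h s = l ^ Suc h / Gamma (\<nu> * real (Suc h)) * s powr (\<nu> * real (Suc h) - 1)" for h s
  have deriv: "(E has_real_derivative (\<Sum>h. g h s)) (at s)" and abs: "summable (\<lambda>h. \<bar>g h s\<bar>)"
    if "s > 0" for s
    using mittag_leffler_powr_derivative[OF assms(1) that, of l] by (simp_all only: E_def[abs_def] g_def)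
  have sums: "(\<lambda>h. (l * t powr \<nu>) ^ h / Gamma (\<nu> * real h + 1)) sums E t"
    unfolding E_def mittag_leffler_def
    using summable_mittag_leffler[OF assms(1)] by (simp add: summable_sums)
  have "has_caputo_derivative \<nu> E (l * E t) t"
  proof (cases "\<nu> = 1")
    case True
    have "g h t = l * ((l * t powr \<nu>) ^ h / Gamma (\<nu> * real h + 1))" for h
      using assms(3) True by (simp add: g_def power_mult_distrib powr_realpow add_ac)
    hence "(\<Sum>h. g h t) = l * E t"
      using sums_unique[OF sums_mult[OF sums, of l]] by simp
    thus ?thesis using True deriv[OF assms(3)] by (simp add: has_caputo_derivative_def)
  next
    case False
    hence "\<nu> < 1" using assms by simp
    define G where "G h s = indicator {0<..<t} s * (g h s / (t - s) powr \<nu>)" for h s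
    have Beta: "has_bochner_integral lborel (\<lambda>s. indicator {0<..<t} s * (s powr (\<nu> * real (Suc h) - 1) / (t - s) powr \<nu>))
        (t powr (\<nu> * real h) * Gamma (\<nu> * real (Suc h)) * Gamma (1 - \<nu>) / Gamma (\<nu> * real h + 1))" for h
    proof -
      have *: "\<nu> * real (Suc h) + (1 - \<nu>) = \<nu> * real h + 1" by (simp add: algebra_simps)
      show ?thesis
        using Beta_integral_interval[of "\<nu> * real (Suc h)" "1 - \<nu>" 0 t] assms \<open>\<nu> < 1\<close>
        by (simp add: Beta_def * powr_minus_divide mult.assoc del: of_nat_Suc)
    qed
    have pos: "Gamma (\<nu> * real (Suc h)) > 0" "Gamma (\<nu> * real h + 1) > 0" for h
      using assms by (auto intro!: Gamma_real_pos add_nonneg_pos)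
    have pw: "t powr (\<nu> * real h) = (t powr \<nu>) ^ h" for h
      using assms by (simp add: powr_powr[symmetric] powr_realpow)
    have G: "has_bochner_integral lborel (G h)
        (Gamma (1 - \<nu>) * l * ((l * t powr \<nu>) ^ h / Gamma (\<nu> * real h + 1)))" for h
    proof -
      have "has_bochner_integral lborel (\<lambda>s. l ^ Suc h / Gamma (\<nu> * real (Suc h)) *
         (indicator {0<..<t} s * (s powr (\<nu> * real (Suc h) - 1) / (t - s) powr \<nu>)))
         (l ^ Suc h / Gamma (\<nu> * real (Suc h)) *
         (t powr (\<nu> * real h) * Gamma (\<nu> * real (Suc h)) * Gamma (1 - \<nu>) / Gamma (\<nu> * real h + 1)))"
        by (intro has_bochner_integral_mult_right Beta)
      also have "(\<lambda>s. l ^ Suc h / Gamma (\<nu> * real (Suc h)) *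
         (indicator {0<..<t} s * (s powr (\<nu> * real (Suc h) - 1) / (t - s) powr \<nu>))) = G h"
        by (simp add: G_def g_def fun_eq_iff)
      also have "l ^ Suc h / Gamma (\<nu> * real (Suc h)) *
         (t powr (\<nu> * real h) * Gamma (\<nu> * real (Suc h)) * Gamma (1 - \<nu>) / Gamma (\<nu> * real h + 1)) =
         Gamma (1 - \<nu>) * l * ((l * t powr \<nu>) ^ h / Gamma (\<nu> * real h + 1))"
        using pos[of h] by (simp add: pw power_mult_distrib del: of_nat_Suc)
      finally show ?thesis .
    qed
    have normG: "has_bochner_integral lborel (\<lambda>s. norm (G h s))
        (Gamma (1 - \<nu>) * \<bar>l\<bar> * ((\<bar>l\<bar> * t powr \<nu>) ^ h / Gamma (\<nu> * real h + 1)))" for h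
    proof -
      have "has_bochner_integral lborel (\<lambda>s. \<bar>l\<bar> ^ Suc h / Gamma (\<nu> * real (Suc h)) *
         (indicator {0<..<t} s * (s powr (\<nu> * real (Suc h) - 1) / (t - s) powr \<nu>)))
         (\<bar>l\<bar> ^ Suc h / Gamma (\<nu> * real (Suc h)) *
         (t powr (\<nu> * real h) * Gamma (\<nu> * real (Suc h)) * Gamma (1 - \<nu>) / Gamma (\<nu> * real h + 1)))"
        by (intro has_bochner_integral_mult_right Beta)
      also have "(\<lambda>s. \<bar>l\<bar> ^ Suc h / Gamma (\<nu> * real (Suc h)) *
         (indicator {0<..<t} s * (s powr (\<nu> * real (Suc h) - 1) / (t - s) powr \<nu>))) = (\<lambda>s. norm (G h s))"
        using pos[of h] by (simp add: G_def g_def fun_eq_iff abs_mult power_abs del: of_nat_Suc)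
      also have "\<bar>l\<bar> ^ Suc h / Gamma (\<nu> * real (Suc h)) *
         (t powr (\<nu> * real h) * Gamma (\<nu> * real (Suc h)) * Gamma (1 - \<nu>) / Gamma (\<nu> * real h + 1)) =
         Gamma (1 - \<nu>) * \<bar>l\<bar> * ((\<bar>l\<bar> * t powr \<nu>) ^ h / Gamma (\<nu> * real h + 1))"
        using pos[of h] by (simp add: pw power_mult_distrib del: of_nat_Suc)
      finally show ?thesis .
    qed
    have int: "integrable lborel (G h)" for h
      using G by (simp add: has_bochner_integral_iff)
    have AEs: "AE s in lborel. summable (\<lambda>h. norm (G h s))"
    proof (rule AE_I2)
      fix s
      show "summable (\<lambda>h. norm (G h s))"
        using summable_divide[OF abs[of s], of "(t - s) powr \<nu>"]
        by (cases "s \<in> {0<..<t}") (auto simp: G_def abs_mult)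
    qed
    have "summable (\<lambda>h. Gamma (1 - \<nu>) * \<bar>l\<bar> * ((\<bar>l\<bar> * t powr \<nu>) ^ h / Gamma (\<nu> * real h + 1)))"
      using summable_mittag_leffler[OF assms(1), of "\<bar>l\<bar> * t powr \<nu>"] by (intro summable_mult) simp
    hence norms: "summable (\<lambda>h. \<integral>s. norm (G h s) \<partial>lborel)"
      by (simp only: has_bochner_integral_integral_eq[OF normG])
    have eq: "(\<Sum>h. G h s) = indicator {0<..<t} s *\<^sub>R (deriv E s / (t - s) powr \<nu>)" for s
    proof (cases "s \<in> {0<..<t}")
      case True
      hence "s > 0" by simp
      have "summable (\<lambda>h. g h s)" using abs[OF \<open>s > 0\<close>] by (rule summable_rabs_cancel)
      thus ?thesis using True DERIV_imp_deriv[OF deriv[OF \<open>s > 0\<close>]]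
        by (simp add: G_def suminf_divide)
    qed (auto simp: G_def)
    have "set_integrable lborel {0<..<t} (\<lambda>s. deriv E s / (t - s) powr \<nu>)"
      using integrable_suminf[OF int AEs norms] by (simp add: set_integrable_def eq)
    moreover have "(LINT s:{0<..<t}|lborel. deriv E s / (t - s) powr \<nu>) = Gamma (1 - \<nu>) * l * E t"
      using integral_suminf[OF int AEs norms] sums_unique[OF sums_mult[OF sums, of "Gamma (1 - \<nu>) * l"]]
      by (simp add: set_lebesgue_integral_def eq has_bochner_integral_integral_eq[OF G])
    moreover have "\<forall>s\<in>{0<..<t}. E differentiable (at s)"
      using deriv by (meson greaterThanLessThan_iff real_differentiable_def)
    moreover have "Gamma (1 - \<nu>) \<noteq> 0" 
      using Gamma_real_pos[of "1 - \<nu>"] \<open>\<nu> < 1\<close> by (metis diff_gt_0_iff_gt less_irrefl)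
    ultimately show ?thesis using False by (simp add: has_caputo_derivative_def)
  qed
  thus ?thesis by (simp add: E_def[abs_def])
qed

lemma continuous_on_mittag_leffler_powr:
  assumes "\<nu> > 0"
  shows "continuous_on {0..} (\<lambda>t. mittag_leffler \<nu> 1 (l * t powr \<nu>))"
proof -
  have "isCont (mittag_leffler \<nu> 1) x" for x
    using isCont_powser_converges_everywhere[OF summable_mittag_leffler[OF assms]]
    by (simp add: mittag_leffler_def[abs_def])
  hence "continuous_on UNIV (mittag_leffler \<nu> 1)" by (simp add: continuous_at_imp_continuous_on)
  thus ?thesis
    by (rule continuous_on_compose2)
       (use assms in \<open>auto intro!: continuous_intros continuous_on_powr'\<close>)
qed

lemma mittag_leffler_0: "mittag_leffler \<nu> 1 0 = 1"
proof -
  have "mittag_leffler \<nu> 1 0 = (\<Sum>h. if h = 0 then 1 else 0)"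
    unfolding mittag_leffler_def by (intro suminf_cong) auto
  also have "\<dots> = 1" using suminf_finite[of "{0}" "\<lambda>h::nat. if h = 0 then 1 else (0::real)"] by simp
  finally show ?thesis .
qed

section \<open>Uniqueness for the relaxation equation\<close>

text \<open>The fractional integral of order \<open>\<nu>\<close> of the Caputo derivative is a double integral of
  \<open>deriv f s\<close> over \<open>0 < s < t < T\<close>. Integrating over \<open>t\<close> first, the two
  kernels combine to the constant \<open>Gamma \<nu> * Gamma (1 - \<nu>)\<close>, which leaves the integral of
  \<open>deriv f\<close>. Continuity of \<open>f\<close> at the endpoints allows the fundamental
  theorem of calculus although \<open>deriv f\<close> may be unbounded near them.\<close>

lemma fractional_integral_caputo:
  fixes f D :: "real \<Rightarrow> real"
  assumes nu: "0 < \<nu>" "\<nu> < 1" and T: "T > 0"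
    and cont: "continuous_on {0..T} f"
    and caputo: "\<And>t. 0 < t \<Longrightarrow> t \<le> T \<Longrightarrow> has_caputo_derivative \<nu> f (D t) t"
  shows "f T - f 0 = 1 / Gamma \<nu> * (LINT t:{0<..<T}|lborel. (T - t) powr (\<nu> - 1) * D t)"
proof -
  define r where "r s = indicator {0<..<T} s * deriv f s" for s
  define B where "B = Gamma \<nu> * Gamma (1 - \<nu>)"
  have Bpos: "Gamma \<nu> > 0" "Gamma (1 - \<nu>) > 0" using nu by (auto intro!: Gamma_real_pos)
  have diff: "f differentiable (at s)" if "s \<in> {0<..<T}" for s
    using caputo[OF T] nu that by (simp add: has_caputo_derivative_def)
  \<comment> \<open>On \<open>{0<..<T}\<close> the kernel \<open>1 / (T - s) powr \<nu>\<close> is at least \<open>1 / T powr \<nu>\<close>, so integrability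
    of the weighted derivative passes to \<open>deriv f\<close> itself.\<close>
  have wint: "integrable lborel (\<lambda>s. indicator {0<..<T} s * (deriv f s / (T - s) powr \<nu>))"
    using caputo[OF T] nu by (simp add: has_caputo_derivative_def set_integrable_def)
  have r_eq: "r s = (indicator {0<..<T} s * (deriv f s / (T - s) powr \<nu>)) * (T - s) powr \<nu>" for s
    by (simp add: r_def indicator_def)
  have [measurable]: "r \<in> borel_measurable borel"
    using borel_measurable_integrable[OF wint] unfolding r_eq[abs_def] by measurable
  have r_int: "integrable lborel r"
  proof (rule Bochner_Integration.integrable_bound[OF integrable_mult_right[OF wint, of "T powr \<nu>"]])
    show "AE s in lborel. norm (r s) \<le>
        norm (T powr \<nu> * (indicator {0<..<T} s * (deriv f s / (T - s) powr \<nu>)))"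
    proof (rule AE_I2)
      fix s
      define y where "y = indicator {0<..<T} s * (deriv f s / (T - s) powr \<nu>)"
      have "\<bar>y\<bar> * (T - s) powr \<nu> \<le> \<bar>y\<bar> * T powr \<nu>"
      proof (cases "s \<in> {0<..<T}")
        case True
        thus ?thesis using nu by (intro mult_left_mono powr_mono2) auto
      qed (simp add: y_def)
      thus "norm (r s) \<le> norm (T powr \<nu> * (indicator {0<..<T} s * (deriv f s / (T - s) powr \<nu>)))"
        unfolding r_eq y_def[symmetric] by (simp add: abs_mult mult.commute)
    qed
  qed auto
  have ftc: "(\<integral>s. r s \<partial>lborel) = f T - f 0"
  proof -
    have "set_integrable lborel {0<..<T} (deriv f)"
      using r_int by (simp add: set_integrable_def r_def[abs_def])
    from set_borel_integral_eq_integral(2)[OF this]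
    have "(\<integral>s. r s \<partial>lborel) = integral {0<..<T} (deriv f)"
      by (simp add: set_lebesgue_integral_def r_def)
    also have "(deriv f has_integral (f T - f 0)) {0..T}"
    proof (rule fundamental_theorem_of_calculus_interior)
      show "(f has_vector_derivative deriv f s) (at s)" if "s \<in> {0<..<T}" for s
        using diff[OF that]
        by (simp add: has_real_derivative_iff_has_vector_derivative[symmetric]
            DERIV_deriv_iff_real_differentiable)
    qed (use T cont in auto)
    hence "integral {0<..<T} (deriv f) = f T - f 0"
      by (simp add: has_integral_Icc_iff_Ioo integral_unique)
    finally show ?thesis .
  qed
  define F where "F = (\<lambda>s t. r s * (indicator {s<..<T} t * ((t - s) powr (- \<nu>) * (T - t) powr (\<nu> - 1))))"
  have F_Beta: "has_bochner_integral lborel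
      (\<lambda>t. indicator {s<..<T} t * ((t - s) powr (- \<nu>) * (T - t) powr (\<nu> - 1))) B" if "s < T" for s
    using Beta_integral_interval[of "1 - \<nu>" \<nu> s T] nu that by (simp add: Beta_def B_def mult.commute)
  have F1: "has_bochner_integral lborel (F s) (r s * B)" for s
  proof (cases "s < T")
    case True
    show ?thesis unfolding F_def by (intro has_bochner_integral_mult_right F_Beta True)
  qed (simp add: F_def r_def has_bochner_integral_zero)
  have F2: "has_bochner_integral lborel (\<lambda>t. norm (F s t)) (\<bar>r s\<bar> * B)" for s
  proof (cases "s < T")
    case True
    have "(\<lambda>t. norm (F s t)) = (\<lambda>t. \<bar>r s\<bar> * (indicator {s<..<T} t * ((t - s) powr (- \<nu>) * (T - t) powr (\<nu> - 1))))"
      by (simp add: F_def abs_mult fun_eq_iff)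
    thus ?thesis using has_bochner_integral_mult_right[OF F_Beta[OF True], of "\<bar>r s\<bar>"] by simp
  qed (simp add: F_def r_def has_bochner_integral_zero)
  have F_meas: "case_prod F \<in> borel_measurable (lborel \<Otimes>\<^sub>M lborel)"
  proof -
    have "case_prod F = (\<lambda>(s, t). r s * (if s < t \<and> t < T then (t - s) powr (- \<nu>) * (T - t) powr (\<nu> - 1) else 0))"
      by (auto simp: F_def fun_eq_iff)
    also have "\<dots> \<in> borel_measurable (lborel \<Otimes>\<^sub>M lborel)" by measurable
    finally show ?thesis .
  qed
  have F_int: "integrable (lborel \<Otimes>\<^sub>M lborel) (case_prod F)"
  proof (rule lborel_pair.Fubini_integrable[OF F_meas])
    show "integrable lborel (\<lambda>s. \<integral>t. norm (case_prod F (s, t)) \<partial>lborel)"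
      using r_int by (simp add: has_bochner_integral_integral_eq[OF F2, simplified])
    show "AE s in lborel. integrable lborel (\<lambda>t. case_prod F (s, t))"
      using F1 by (simp add: has_bochner_integral_iff)
  qed
  have inner: "(\<integral>s. F s t \<partial>lborel) = indicator {0<..<T} t * (Gamma (1 - \<nu>) * ((T - t) powr (\<nu> - 1) * D t))" for t
  proof (cases "t \<in> {0<..<T}")
    case True
    have "(\<lambda>s. F s t) = (\<lambda>s. (T - t) powr (\<nu> - 1) * (indicator {0<..<t} s * (deriv f s / (t - s) powr \<nu>)))"
      using True by (auto simp: F_def r_def fun_eq_iff indicator_def powr_minus_divide)
    moreover have "(LINT s:{0<..<t}|lborel. deriv f s / (t - s) powr \<nu>) = Gamma (1 - \<nu>) * D t"
      using caputo[of t] True nu Bpos(2)[THEN less_imp_neq] by (simp add: has_caputo_derivative_def)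
    ultimately have "(\<integral>s. F s t \<partial>lborel) = (T - t) powr (\<nu> - 1) * (Gamma (1 - \<nu>) * D t)"
      by (simp only: set_lebesgue_integral_def integral_mult_right_zero real_scaleR_def)
    thus ?thesis using True by simp
  next
    case False
    hence "(\<lambda>s. F s t) = (\<lambda>s. 0)"
      by (auto simp: F_def r_def fun_eq_iff indicator_def)
    thus ?thesis using False by simp
  qed
  have "Gamma (1 - \<nu>) * (LINT t:{0<..<T}|lborel. (T - t) powr (\<nu> - 1) * D t) =
      (\<integral>t. (\<integral>s. F s t \<partial>lborel) \<partial>lborel)"
    unfolding inner set_lebesgue_integral_def by (simp add: mult.left_commute)
  also have "\<dots> = (\<integral>s. (\<integral>t. F s t \<partial>lborel) \<partial>lborel)"
    by (rule lborel_pair.Fubini_integral[OF F_int])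
  also have "\<dots> = (f T - f 0) * B"
    by (simp add: has_bochner_integral_integral_eq[OF F1] ftc)
  finally have "Gamma (1 - \<nu>) * (LINT t:{0<..<T}|lborel. (T - t) powr (\<nu> - 1) * D t) =
      Gamma (1 - \<nu>) * (Gamma \<nu> * (f T - f 0))"
    by (simp only: B_def mult_ac)
  hence "(LINT t:{0<..<T}|lborel. (T - t) powr (\<nu> - 1) * D t) = Gamma \<nu> * (f T - f 0)"
    using Bpos(2)[THEN less_imp_neq] by (metis mult_left_cancel)
  thus ?thesis using Bpos(1) by simp
qed

text \<open>A Gronwall inequality for Abel's kernel. Each substitution of the current bound into the
  inequality is one Beta integral, so \<open>n\<close> substitutions bound \<open>\<bar>u t\<bar>\<close> by \<open>M\<close> times the
  \<open>n\<close>-th term of the Mittag-Leffler series at \<open>C * Gamma \<nu> * t powr \<nu>\<close>, which tends to \<open>0\<close>.\<close>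

lemma abel_gronwall:
  fixes u :: "real \<Rightarrow> real"
  assumes nu: "\<nu> > 0" and "C \<ge> 0"
    and bdd: "\<And>t. 0 < t \<Longrightarrow> t \<le> T \<Longrightarrow> \<bar>u t\<bar> \<le> M"
    and ineq: "\<And>t. 0 < t \<Longrightarrow> t \<le> T \<Longrightarrow>
                 \<bar>u t\<bar> \<le> C * (LINT s:{0<..<t}|lborel. (t - s) powr (\<nu> - 1) * \<bar>u s\<bar>)"
    and t: "0 < t" "t \<le> T"
  shows "u t = 0"
proof -
  have bound: "\<bar>u t\<bar> \<le> M * (C * Gamma \<nu>) ^ n * t powr (\<nu> * real n) / Gamma (\<nu> * real n + 1)"
    if "0 < t" "t \<le> T" for n t
    using that
  proof (induction n arbitrary: t)
    case 0
    thus ?case using bdd by simp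
  next
    case (Suc n)
    define K where "K = M * (C * Gamma \<nu>) ^ n / Gamma (\<nu> * real n + 1)"
    have pos: "Gamma (\<nu> * real n + 1) > 0" using nu by (auto intro!: Gamma_real_pos add_nonneg_pos)
    have K: "\<bar>u s\<bar> \<le> K * s powr (\<nu> * real n)" if "0 < s" "s \<le> T" for s
      using Suc.IH[OF that] by (simp add: K_def)
    have "K * t powr (\<nu> * real n) \<ge> 0" using K[OF Suc.prems] by linarith
    hence "K \<ge> 0" using Suc.prems by (simp add: zero_le_mult_iff)
    have "has_bochner_integral lborel
        (\<lambda>s. K * (indicator {0<..<t} s * (s powr (\<nu> * real n) * (t - s) powr (\<nu> - 1))))
        (K * (t powr (\<nu> * real n + \<nu>) * Beta (\<nu> * real n + 1) \<nu>))"
      using Beta_integral_interval[of "\<nu> * real n + 1" \<nu> 0 t] nu Suc.prems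
        add_nonneg_pos[of "\<nu> * real n" 1]
      by (intro has_bochner_integral_mult_right) (auto simp: algebra_simps)
    hence int: "integrable lborel (\<lambda>s. K * (indicator {0<..<t} s * (s powr (\<nu> * real n) * (t - s) powr (\<nu> - 1))))"
      and val: "(\<integral>s. K * (indicator {0<..<t} s * (s powr (\<nu> * real n) * (t - s) powr (\<nu> - 1))) \<partial>lborel) =
        K * (t powr (\<nu> * real n + \<nu>) * Beta (\<nu> * real n + 1) \<nu>)"
      by (simp_all add: has_bochner_integral_iff)
    have "(LINT s:{0<..<t}|lborel. (t - s) powr (\<nu> - 1) * \<bar>u s\<bar>) \<le>
        (\<integral>s. K * (indicator {0<..<t} s * (s powr (\<nu> * real n) * (t - s) powr (\<nu> - 1))) \<partial>lborel)"
      unfolding set_lebesgue_integral_def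
    proof (rule integral_mono'[OF int])
      fix s
      show "indicator {0<..<t} s *\<^sub>R ((t - s) powr (\<nu> - 1) * \<bar>u s\<bar>) \<le>
         K * (indicator {0<..<t} s * (s powr (\<nu> * real n) * (t - s) powr (\<nu> - 1)))"
      proof (cases "s \<in> {0<..<t}")
        case True
        have "(t - s) powr (\<nu> - 1) * \<bar>u s\<bar> \<le> (t - s) powr (\<nu> - 1) * (K * s powr (\<nu> * real n))"
          using True Suc.prems by (intro mult_left_mono K) auto
        thus ?thesis using True by (simp add: mult_ac)
      qed simp
      show "0 \<le> K * (indicator {0<..<t} s * (s powr (\<nu> * real n) * (t - s) powr (\<nu> - 1)))"
        using \<open>K \<ge> 0\<close> by simp
    qed
    hence "\<bar>u t\<bar> \<le> C * (K * (t powr (\<nu> * real n + \<nu>) * Beta (\<nu> * real n + 1) \<nu>))"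
      using ineq[OF Suc.prems] \<open>C \<ge> 0\<close> unfolding val by (meson mult_left_mono order_trans)
    also have "\<dots> = M * (C * Gamma \<nu>) ^ Suc n * t powr (\<nu> * real (Suc n)) / Gamma (\<nu> * real (Suc n) + 1)"
      using pos by (simp add: K_def Beta_def algebra_simps)
    finally show ?case .
  qed
  have "(\<lambda>n. 1 / Gamma (\<nu> * real n + 1) * (C * Gamma \<nu> * t powr \<nu>) ^ n) \<longlonglongrightarrow> 0"
    by (rule summable_LIMSEQ_zero[OF summable_mittag_leffler[OF nu]])
  from tendsto_mult_right_zero[OF this, of M]
  have "(\<lambda>n. M * (C * Gamma \<nu>) ^ n * t powr (\<nu> * real n) / Gamma (\<nu> * real n + 1)) \<longlonglongrightarrow> 0"
    using t by (simp add: power_mult_distrib powr_powr[symmetric] powr_realpow mult_ac)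
  hence "\<bar>u t\<bar> \<le> 0"
    by (rule LIMSEQ_le_const) (use bound[OF t] in auto)
  thus ?thesis by simp
qed

lemma caputo_relaxation_unique:
  fixes q :: "real \<Rightarrow> real"
  assumes nu: "0 < \<nu>" "\<nu> \<le> 1" and cont: "continuous_on {0..} q" and q0: "q 0 = 0"
    and eq: "\<And>t. t > 0 \<Longrightarrow> has_caputo_derivative \<nu> q (l * q t) t"
    and t: "t \<ge> 0"
  shows "q t = 0"
proof (cases "t = 0")
  case False
  hence t: "t > 0" using t by simp
  have contT: "continuous_on {0..s} q" for s
    using cont by (rule continuous_on_subset) auto
  show ?thesis
  proof (cases "\<nu> = 1")
    case True
    have "exp (- l * t) * q t = exp (- l * 0) * q 0"
    proof (rule DERIV_isconst_end[OF t])
      show "continuous_on {0..t} (\<lambda>t. exp (- l * t) * q t)"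
        by (intro continuous_intros contT)
      fix x :: real assume "0 < x"
      hence "(q has_real_derivative l * q x) (at x)"
        using eq[of x] True by (simp add: has_caputo_derivative_def)
      thus "((\<lambda>t. exp (- l * t) * q t) has_real_derivative 0) (at x)"
        by (auto intro!: derivative_eq_intros)
    qed
    thus ?thesis by (simp add: q0)
  next
    case False
    hence "\<nu> < 1" using nu by simp
    have "bounded (q ` {0..t})"
      by (intro compact_imp_bounded compact_continuous_image contT) auto
    then obtain M where M: "\<And>s. 0 \<le> s \<Longrightarrow> s \<le> t \<Longrightarrow> \<bar>q s\<bar> \<le> M"
      unfolding bounded_iff by (metis atLeastAtMost_iff imageI real_norm_def)
    have Gpos: "Gamma \<nu> > 0" using nu by (intro Gamma_real_pos)
    \<comment> \<open>Fractional integration turns the differential equation into a Volterra inequality.\<close>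
    have volterra: "\<bar>q s\<bar> \<le> \<bar>l\<bar> / Gamma \<nu> * (LINT x:{0<..<s}|lborel. (s - x) powr (\<nu> - 1) * \<bar>q x\<bar>)"
      if "0 < s" for s
    proof -
      have "q s = 1 / Gamma \<nu> * (LINT x:{0<..<s}|lborel. (s - x) powr (\<nu> - 1) * (l * q x))"
        using fractional_integral_caputo[OF nu(1) \<open>\<nu> < 1\<close> that contT, of "\<lambda>x. l * q x"] eq q0 by simp
      also have "(LINT x:{0<..<s}|lborel. (s - x) powr (\<nu> - 1) * (l * q x)) =
           l * (LINT x:{0<..<s}|lborel. (s - x) powr (\<nu> - 1) * q x)"
        by (simp only: mult.left_commute[of _ l] set_integral_mult_right)
      finally have "\<bar>q s\<bar> = \<bar>l\<bar> / Gamma \<nu> * \<bar>LINT x:{0<..<s}|lborel. (s - x) powr (\<nu> - 1) * q x\<bar>"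
        using Gpos by (simp add: abs_mult)
      also have "\<bar>LINT x:{0<..<s}|lborel. (s - x) powr (\<nu> - 1) * q x\<bar> \<le>
          (\<integral>x. norm (indicator {0<..<s} x *\<^sub>R ((s - x) powr (\<nu> - 1) * q x)) \<partial>lborel)"
        unfolding set_lebesgue_integral_def
        using integral_norm_bound[of lborel "\<lambda>x. indicator {0<..<s} x *\<^sub>R ((s - x) powr (\<nu> - 1) * q x)"] by simp
      also have "\<dots> = (LINT x:{0<..<s}|lborel. (s - x) powr (\<nu> - 1) * \<bar>q x\<bar>)"
        by (simp add: set_lebesgue_integral_def abs_mult)
      finally show ?thesis using Gpos by (simp add: mult_left_mono divide_right_mono)
    qed
    show ?thesis
      by (rule abel_gronwall[of \<nu> "\<bar>l\<bar> / Gamma \<nu>" t q M]) (use nu Gpos t M volterra in auto)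
  qed
qed (use q0 in simp)

section \<open>The fractional birth equations\<close>

text \<open>The formula for \<open>k > 1\<close> also covers \<open>k = 1\<close>, both products then being empty. This makes the
  state probabilities uniformly linear combinations of eigenfunctions.\<close>

lemma birth_state_prob_eq:
  assumes "k \<ge> 1"
  shows "birth_state_prob \<nu> lam k t =
     (\<Sum>m=1..k. (\<Prod>j=1..k-1. lam j) * (1 / (\<Prod>l\<in>{1..k} - {m}. lam l - lam m)) *
        mittag_leffler \<nu> 1 (- lam m * t powr \<nu>))"
  by (cases "k = 1") (simp_all add: birth_state_prob_def sum_distrib_left mult.assoc)

text \<open>At time \<open>0\<close> every Mittag-Leffler factor is \<open>1\<close>, so only the divided-difference sum over the
  nodes \<open>lam 1, \<dots>, lam k\<close> is left.\<close>

lemma birth_state_prob_0: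
  assumes "inj_on lam {1..}" "k \<ge> 1"
  shows "birth_state_prob \<nu> lam k 0 = (if k = 1 then 1 else 0)"
proof (cases "k = 1")
  case True
  thus ?thesis by (simp add: birth_state_prob_def mittag_leffler_0)
next
  case False
  have inj: "inj_on lam {1..k}" using assms(1) by (rule inj_on_subset) auto
  have "(\<Sum>m=1..k. 1 / (\<Prod>l\<in>{1..k} - {m}. lam l - lam m)) =
        (\<Sum>m\<in>{1..k}. 1 / (\<Prod>x\<in>lam ` {1..k} - {lam m}. x - lam m))"
  proof (intro sum.cong refl)
    fix m assume m: "m \<in> {1..k}"
    have "lam ` {1..k} - {lam m} = lam ` ({1..k} - {m})"
      using inj_on_image_set_diff[OF inj, of "{1..k}" "{m}"] m by simp
    moreover have "inj_on lam ({1..k} - {m})" using inj by (rule inj_on_subset) auto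
    ultimately show "1 / (\<Prod>l\<in>{1..k} - {m}. lam l - lam m) =
        1 / (\<Prod>x\<in>lam ` {1..k} - {lam m}. x - lam m)"
      by (simp add: prod.reindex)
  qed
  also have "\<dots> = (\<Sum>y\<in>lam ` {1..k}. 1 / (\<Prod>x\<in>lam ` {1..k} - {y}. x - y))"
    using inj by (simp add: sum.reindex)
  also have "\<dots> = 0"
    using inj False assms(2) by (intro sum_inverse_prod_differences) (auto simp: card_image)
  finally show ?thesis
    using False by (simp add: birth_state_prob_def mittag_leffler_0)
qed

text \<open>Differentiation multiplies the \<open>m\<close>-th summand by \<open>- lam m = - lam k + (lam k - lam m)\<close>. The
  factor \<open>lam k - lam m\<close> cancels the factor \<open>l = k\<close> of the denominator and so yields the inflow
  from state \<open>k - 1\<close>.\<close>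

lemma has_caputo_derivative_birth_state_prob:
  assumes nu: "0 < \<nu>" "\<nu> \<le> 1" and inj: "inj_on lam {1..}" and k: "k \<ge> 1" and t: "t > 0"
  shows "has_caputo_derivative \<nu> (birth_state_prob \<nu> lam k)
           (if k = 1 then - lam 1 * birth_state_prob \<nu> lam 1 t
            else - lam k * birth_state_prob \<nu> lam k t
                 + lam (k - 1) * birth_state_prob \<nu> lam (k - 1) t) t"
proof -
  define P where "P = (\<Prod>j=1..k-1. lam j)"
  define Q where "Q m = (\<Prod>l\<in>{1..k} - {m}. lam l - lam m)" for m
  define E where "E m = mittag_leffler \<nu> 1 (- lam m * t powr \<nu>)" for m
  have D: "has_caputo_derivative \<nu> (birth_state_prob \<nu> lam k)
      (\<Sum>m=1..k. P * (1 / Q m) * (- lam m * E m)) t"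
    unfolding birth_state_prob_eq[OF k, abs_def] P_def Q_def E_def
    by (intro has_caputo_derivative_sum has_caputo_derivative_cmult
        has_caputo_derivative_mittag_leffler nu t)
  have b: "birth_state_prob \<nu> lam k t = (\<Sum>m=1..k. P * (1 / Q m) * E m)"
    by (simp add: birth_state_prob_eq[OF k] P_def Q_def E_def)
  show ?thesis
  proof (cases "k = 1")
    case True
    thus ?thesis using D b by (simp add: mult_ac)
  next
    case False
    have k1: "k - 1 \<ge> 1" using False k by simp
    have P: "P = lam (k - 1) * (\<Prod>j=1..k-1-1. lam j)"
      unfolding P_def using k1 by (cases "k - 1") (auto simp: prod.atLeast1_atMost_eq)
    have Q: "Q m = (lam k - lam m) * (\<Prod>l\<in>{1..k-1} - {m}. lam l - lam m)" if "m \<in> {1..k-1}" for m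
    proof -
      have "{1..k} - {m} = insert k ({1..k-1} - {m})" using that by auto
      moreover have "k \<notin> {1..k-1} - {m}" using k by auto
      ultimately show ?thesis unfolding Q_def by simp
    qed
    have ne: "lam k \<noteq> lam m" if "m \<in> {1..k-1}" for m
      using inj_onD[OF inj, of k m] that k by auto
    have "lam (k - 1) * birth_state_prob \<nu> lam (k - 1) t =
        (\<Sum>m=1..k-1. P * (1 / (\<Prod>l\<in>{1..k-1} - {m}. lam l - lam m)) * E m)"
      unfolding birth_state_prob_eq[OF k1] P E_def by (simp add: sum_distrib_left mult.assoc)
    also have "\<dots> = (\<Sum>m=1..k-1. (lam k - lam m) * (P * (1 / Q m) * E m))"
      by (intro sum.cong refl) (use Q ne in simp)
    \<comment> \<open>The summand \<open>m = k\<close>, absent at level \<open>k - 1\<close>, may be added because its factor \<open>lam k - lam m\<close> is \<open>0\<close>.\<close>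
    also have "\<dots> = (\<Sum>m=1..k. (lam k - lam m) * (P * (1 / Q m) * E m))"
      by (rule sum.mono_neutral_left) (use not_less_eq_eq in \<open>force+\<close>)
    finally have "- lam k * birth_state_prob \<nu> lam k t + lam (k - 1) * birth_state_prob \<nu> lam (k - 1) t =
      (\<Sum>m=1..k. P * (1 / Q m) * (- lam m * E m))"
      unfolding b sum_distrib_left by (simp add: sum.distrib[symmetric] algebra_simps diff_divide_distrib)
    thus ?thesis using D False by simp
  qed
qed

lemma continuous_on_birth_state_prob:
  assumes "\<nu> > 0" "k \<ge> 1"
  shows "continuous_on {0..} (birth_state_prob \<nu> lam k)"
  unfolding birth_state_prob_eq[OF assms(2), abs_def]
  by (intro continuous_intros continuous_on_mittag_leffler_powr assms)

lemma fractional_birth_solution_birth_state_prob: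
  assumes "0 < \<nu>" "\<nu> \<le> 1" "inj_on lam {1..}"
  shows "fractional_birth_solution \<nu> lam (birth_state_prob \<nu> lam)"
  using assms birth_state_prob_0 continuous_on_birth_state_prob
    has_caputo_derivative_birth_state_prob
  by (simp add: fractional_birth_solution_def)

lemma fractional_birth_solution_cong:
  assumes "\<And>k t. k \<ge> 1 \<Longrightarrow> t \<ge> 0 \<Longrightarrow> p k t = q k t"
  shows "fractional_birth_solution \<nu> lam p \<longleftrightarrow> fractional_birth_solution \<nu> lam q"
proof -
  have "continuous_on {0..} (p k) \<longleftrightarrow> continuous_on {0..} (q k)" if "k \<ge> 1" for k
    using assms that by (intro continuous_on_cong) auto
  moreover have "has_caputo_derivative \<nu> (p k) D t \<longleftrightarrow> has_caputo_derivative \<nu> (q k) D t"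
    if "k \<ge> 1" "t > 0" for k t D
    using assms that by (intro has_caputo_derivative_cong) auto
  moreover have "(if k = 1 then - lam 1 * p 1 t else - lam k * p k t + lam (k - 1) * p (k - 1) t) =
     (if k = 1 then - lam 1 * q 1 t else - lam k * q k t + lam (k - 1) * q (k - 1) t)"
    if "k \<ge> 1" "t > 0" for k t
    using assms that by auto
  ultimately show ?thesis
    using assms unfolding fractional_birth_solution_def by (simp cong: if_cong)
qed

text \<open>By the induction hypothesis the inflow terms of two solutions agree at level \<open>k\<close>, so their
  difference solves the homogeneous relaxation equation with rate \<open>lam k\<close>.\<close>

lemma fractional_birth_solution_unique:
  assumes nu: "0 < \<nu>" "\<nu> \<le> 1"
    and p: "fractional_birth_solution \<nu> lam p" and q: "fractional_birth_solution \<nu> lam q"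
    and "k \<ge> 1" "t \<ge> 0"
  shows "p k t = q k t"
  using \<open>k \<ge> 1\<close> \<open>t \<ge> 0\<close>
proof (induction k arbitrary: t rule: less_induct)
  case (less k)
  let ?d = "\<lambda>s. p k s + (-1) * q k s"
  have "?d t = 0"
  proof (rule caputo_relaxation_unique[OF nu, where q = ?d and l = "- lam k"])
    show "continuous_on {0..} ?d" "?d 0 = 0"
      using p q less.prems
      by (auto simp: fractional_birth_solution_def intro!: continuous_intros)
    show "has_caputo_derivative \<nu> ?d (- lam k * ?d s) s" if "s > 0" for s
    proof -
      have inflow: "p (k - 1) s = q (k - 1) s" if "k \<noteq> 1"
        using less.IH[of "k - 1" s] less.prems that \<open>s > 0\<close> by simp
      have "has_caputo_derivative \<nu> ?d
         ((if k = 1 then - lam 1 * p 1 s else - lam k * p k s + lam (k - 1) * p (k - 1) s) +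
          (-1) * (if k = 1 then - lam 1 * q 1 s else - lam k * q k s + lam (k - 1) * q (k - 1) s)) s"
        using p q less.prems \<open>s > 0\<close> unfolding fractional_birth_solution_def
        by (intro has_caputo_derivative_add has_caputo_derivative_cmult) blast+
      thus ?thesis using inflow by (cases "k = 1") (simp_all add: algebra_simps)
    qed
  qed (use less.prems in auto)
  thus ?case by simp
qed

theorem theorem2p1:
  fixes \<nu> :: real and lam :: "nat \<Rightarrow> real"
    and M :: "'a measure" and N :: "real \<Rightarrow> 'a \<Rightarrow> enat"
  assumes "0 < \<nu>" and "\<nu> \<le> 1"
    and "\<And>k. k \<ge> 1 \<Longrightarrow> lam k > 0"
    and "inj_on lam {1..}"
  shows "(\<forall>p. fractional_birth_solution \<nu> lam p \<longleftrightarrow>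
               (\<forall>k\<ge>1. \<forall>t\<ge>0. p k t = birth_state_prob \<nu> lam k t)) \<and>
         (fractional_birth_process M N \<nu> lam \<longrightarrow>
           (\<forall>k\<ge>1. \<forall>t\<ge>0. \<P>(\<omega> in M. N t \<omega> = enat k \<bar> N 0 \<omega> = 1) = birth_state_prob \<nu> lam k t))"
proof -
  have sol: "fractional_birth_solution \<nu> lam (birth_state_prob \<nu> lam)"
    using assms(1,2,4) by (rule fractional_birth_solution_birth_state_prob)
  have iff: "fractional_birth_solution \<nu> lam p \<longleftrightarrow>
      (\<forall>k\<ge>1. \<forall>t\<ge>0. p k t = birth_state_prob \<nu> lam k t)" for p
  proof
    assume "fractional_birth_solution \<nu> lam p"
    thus "\<forall>k\<ge>1. \<forall>t\<ge>0. p k t = birth_state_prob \<nu> lam k t"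
      using fractional_birth_solution_unique[OF assms(1,2) _ sol] by blast
  next
    assume "\<forall>k\<ge>1. \<forall>t\<ge>0. p k t = birth_state_prob \<nu> lam k t"
    thus "fractional_birth_solution \<nu> lam p"
      using sol fractional_birth_solution_cong[of p "birth_state_prob \<nu> lam"] by blast
  qed
  show ?thesis
  proof (intro conjI allI impI)
    fix k :: nat and t :: real
    assume "fractional_birth_process M N \<nu> lam" "k \<ge> 1" "t \<ge> 0"
    hence "fractional_birth_solution \<nu> lam (\<lambda>k t. \<P>(\<omega> in M. N t \<omega> = enat k \<bar> N 0 \<omega> = 1))"
      by (simp add: fractional_birth_process_def)
    thus "\<P>(\<omega> in M. N t \<omega> = enat k \<bar> N 0 \<omega> = 1) = birth_state_prob \<nu> lam k t"
      using iff[of "\<lambda>k t. \<P>(\<omega> in M. N t \<omega> = enat k \<bar> N 0 \<omega> = 1)"] \<open>k \<ge> 1\<close> \<open>t \<ge> 0\<close> by simp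
  qed (fact iff)
qed

end
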